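(* Let $P=S^1$ be the one-dimensional sphere, and let $n\ge3$. Then on the $n$-dimensional sphere $S^n$ there exists a $P$-function whose number of singularities (critical submanifolds) does not exceed $[n/2]+1$.
   Context: **$P$-function.** Let $P$ be a fixed smooth manifold without boundary. A differentiable function on a manifold whose set of critical points is a disjoint union of smooth submanifolds without boundary is called a $P$-function if each of its critical submanifolds is homeomorphic to $P$. Here $[x]$ denotes the integer part of $x$. *)

theory Defs
  imports "HOL-Analysis.Analysis"
begin

text \<open>
  Manifolds are embedded smooth submanifolds of a Euclidean space, without boundary.
  ``Smooth'' and ``differentiable'' both mean C-infinity.
\<close>

text \<open>
  The following two predicates are meant for an open domain \<open>S\<close> only: the derivatives are the
  full Frechet derivatives at the points of \<open>S\<close>.
\<close>

primrec Ck_on ::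
  "nat \<Rightarrow> ('a::euclidean_space \<Rightarrow> 'b::euclidean_space) \<Rightarrow> 'a set \<Rightarrow> bool" where
  "Ck_on 0 f S \<longleftrightarrow> continuous_on S f"
| "Ck_on (Suc k) f S \<longleftrightarrow>
     (\<forall>x\<in>S. f differentiable (at x)) \<and>
     (\<forall>v. Ck_on k (\<lambda>x. frechet_derivative f (at x) v) S)"

definition smooth_on_open ::
  "('a::euclidean_space \<Rightarrow> 'b::euclidean_space) \<Rightarrow> 'a set \<Rightarrow> bool" where
  "smooth_on_open f S \<longleftrightarrow> (\<forall>k. Ck_on k f S)"

text \<open>On an arbitrary subset, smooth means locally the restriction of a smooth ambient map.\<close>

definition smooth_map_on ::
  "('a::euclidean_space \<Rightarrow> 'b::euclidean_space) \<Rightarrow> 'a set \<Rightarrow> bool" where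
  "smooth_map_on f M \<longleftrightarrow>
     (\<forall>x\<in>M. \<exists>U g. open U \<and> x \<in> U \<and> smooth_on_open g U \<and> (\<forall>y\<in>M \<inter> U. g y = f y))"

text \<open>
  Slice-chart definition: near each point an ambient diffeomorphism straightens \<open>N\<close> to an open
  piece of a \<open>d\<close>-dimensional linear subspace.  For \<open>N \<subseteq> M\<close> with both sets embedded in the ambient
  space, \<open>N\<close> is then an embedded submanifold of \<open>M\<close>.
\<close>

definition smooth_submanifold :: "nat \<Rightarrow> 'a::euclidean_space set \<Rightarrow> bool" where
  "smooth_submanifold d N \<longleftrightarrow>
     (\<forall>x\<in>N. \<exists>U V \<phi> \<psi> L.
        open U \<and> open V \<and> x \<in> U \<and>
        homeomorphism U V \<phi> \<psi> \<and> smooth_on_open \<phi> U \<and> smooth_on_open \<psi> V \<and>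
        subspace L \<and> dim L = d \<and> \<phi> ` (N \<inter> U) = L \<inter> (V :: 'a set))"

text \<open>
  The point \<open>x\<close> is critical if the differential of \<open>f\<close> at \<open>x\<close> vanishes on the tangent space of
  \<open>M\<close>, whose vectors are the velocities of smooth curves in \<open>M\<close> through \<open>x\<close>; the differential
  takes the velocity of \<open>\<gamma>\<close> to the derivative of \<open>f \<circ> \<gamma>\<close>.
\<close>

definition critical_points :: "('a::euclidean_space \<Rightarrow> real) \<Rightarrow> 'a set \<Rightarrow> 'a set" where
  "critical_points f M =
     {x \<in> M. \<forall>e>0. \<forall>\<gamma> :: real \<Rightarrow> 'a.
        smooth_on_open \<gamma> {-e<..<e} \<and> \<gamma> ` {-e<..<e} \<subseteq> M \<and> \<gamma> 0 = x \<longrightarrow>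
        ((f \<circ> \<gamma>) has_real_derivative 0) (at 0)}"

text \<open>
  \<open>\<C>\<close> presents the critical set as a disjoint union of submanifolds.  The union is topological
  (each member is open in the critical set): a merely set-theoretic partition would allow, for
  instance, a critical torus to be counted as a family of circles.
\<close>

definition critical_submanifolds ::
  "('a::euclidean_space \<Rightarrow> real) \<Rightarrow> 'a set \<Rightarrow> 'a set set \<Rightarrow> bool" where
  "critical_submanifolds f M \<C> \<longleftrightarrow>
     \<Union>\<C> = critical_points f M \<and> pairwise disjnt \<C> \<and>
     (\<forall>C\<in>\<C>. C \<noteq> {} \<and> openin (top_of_set (critical_points f M)) C \<and>
            (\<exists>d. smooth_submanifold d C))"

text \<open>
  \<open>\<C>\<close> is a parameter so that the critical submanifolds can be counted.
\<close>

definition P_function ::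
  "'b::euclidean_space set \<Rightarrow> 'a::euclidean_space set \<Rightarrow> ('a \<Rightarrow> real) \<Rightarrow> 'a set set \<Rightarrow> bool" where
  "P_function P M f \<C> \<longleftrightarrow>
     (\<exists>d. smooth_submanifold d P) \<and> (\<exists>d. smooth_submanifold d M) \<and>
     smooth_map_on f M \<and> critical_submanifolds f M \<C> \<and>
     (\<forall>C\<in>\<C>. C homeomorphic P)"

end

theory Submission
  imports Defs
begin

text \<open>
  If the number \<open>n + 1\<close> of coordinates is even, group them into pairs and give each pair a
  weight of its own.  The critical points of the weighted sum of squares on the sphere are the unit
  eigenvectors, so they form one great circle for each of the \<open>(n + 1) div 2\<close> pairs.

  If \<open>n + 1\<close> is odd, one coordinate \<open>t\<close> is left over and the same function has two isolated
  critical points, the poles of the \<open>t\<close>-axis.  No choice of nondegenerate critical circles can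
  avoid this, because circles have Euler characteristic 0 and the sphere has Euler characteristic
  2.  The remedy is a degenerate circle.  On the four-sphere with coordinates \<open>z\<close>, \<open>w\<close> in
  the plane and \<open>t\<close>, the form \<open>\<bar>w\<bar>\<^sup>2 - \<bar>z\<bar>\<^sup>2\<close> is critical on the
  circles \<open>\<bar>z\<bar> = 1\<close> and \<open>\<bar>w\<bar> = 1\<close> and at the two poles.  The poles lie on the
  level 0, which contains the great circle \<open>z = w = (x, 0)\<close> passing through both.  Multiplying the
  form by a nonnegative function that vanishes exactly on this circle leaves the sign of the
  form unchanged elsewhere but turns the whole circle into critical points.  A
  homogeneous polynomial factor that creates no other critical points yields a function with three
  critical circles (\<open>merging_poly_critical\<close>).

  The remaining coordinates are paired as before, with weights that dominate the growth of this
  polynomial; every pair adds one circle (\<open>P_function_join\<close>).  With \<open>n = 4 + 2 * k\<close> this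
  gives \<open>k + 3 = n div 2 + 1\<close> circles.

  All critical circles are great circles.  This reduces the manifold part to great spheres, for which
  inversion in a sphere is a slice chart (\<open>smooth_submanifold_great_sphere\<close>), and the
  topological part to planes meeting only in the origin (\<open>P_function_great_circles\<close>).
\<close>

section \<open>Calculus of smooth maps\<close>

lemma Ck_on_cong:
  assumes "open S" "\<And>x. x \<in> S \<Longrightarrow> f x = g x"
  shows "Ck_on k f S \<longleftrightarrow> Ck_on k g S"
  using assms(2)
proof (induction k arbitrary: f g)
  case 0
  then show ?case by (simp cong: continuous_on_cong)
next
  case (Suc k)
  have D: "(f has_derivative D) (at x) \<longleftrightarrow> (g has_derivative D) (at x)" if "x \<in> S" for x D
    using has_derivative_transform_within_open[OF _ assms(1) that] Suc.prems by metis
  have fd: "frechet_derivative f (at x) = frechet_derivative g (at x)" if "x \<in> S" for x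
    unfolding frechet_derivative_def using D[OF that] by simp
  have df: "f differentiable (at x) \<longleftrightarrow> g differentiable (at x)" if "x \<in> S" for x
    unfolding differentiable_def using D[OF that] by simp
  have "Ck_on k (\<lambda>x. frechet_derivative f (at x) v) S =
        Ck_on k (\<lambda>x. frechet_derivative g (at x) v) S" for v
    using fd by (intro Suc.IH) simp
  with df show ?case by simp
qed

text \<open>
  Every closure property below follows from this rule by induction on the order: it suffices to
  exhibit some derivative and to know that its directional values are of lower order.
\<close>

lemma Ck_on_SucI:
  assumes "open S"
    and "\<And>x. x \<in> S \<Longrightarrow> (f has_derivative D x) (at x)"
    and "\<And>v. Ck_on k (\<lambda>x. D x v) S"
  shows "Ck_on (Suc k) f S"
proof -
  have "frechet_derivative f (at x) = D x" if "x \<in> S" for x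
    using frechet_derivative_at[OF assms(2)[OF that]] by simp
  then have "Ck_on k (\<lambda>x. frechet_derivative f (at x) v) S" for v
    using Ck_on_cong[OF assms(1), of "\<lambda>x. frechet_derivative f (at x) v" "\<lambda>x. D x v"] assms(3)
    by simp
  then show ?thesis
    using assms(2) by (auto simp: differentiable_def)
qed

lemma Ck_on_SucD:
  assumes "Ck_on (Suc k) f S" "x \<in> S"
  shows "(f has_derivative frechet_derivative f (at x)) (at x)"
  using assms by (simp add: frechet_derivative_works)

lemma Ck_on_Suc_imp: "Ck_on (Suc k) f S \<Longrightarrow> Ck_on k f S"
proof (induction k arbitrary: f)
  case 0
  then show ?case
    by (auto intro!: differentiable_imp_continuous_on differentiable_at_imp_differentiable_on)
qed auto

lemma Ck_on_const: "open S \<Longrightarrow> Ck_on k (\<lambda>_. c) S"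
proof (induction k arbitrary: c)
  case (Suc k)
  then show ?case by (intro Ck_on_SucI[where D = "\<lambda>_ _. 0"]) (auto intro: derivative_intros)
qed simp

lemma Ck_on_bounded_linear:
  assumes "bounded_linear f" "open S"
  shows "Ck_on k f S"
proof (cases k)
  case 0
  then show ?thesis using assms by (simp add: linear_continuous_on)
next
  case (Suc j)
  show ?thesis unfolding Suc
    by (rule Ck_on_SucI[OF assms(2), where D = "\<lambda>_. f"])
      (auto intro: assms bounded_linear_imp_has_derivative Ck_on_const)
qed

lemma Ck_on_add:
  assumes "open S"
  shows "Ck_on k f S \<Longrightarrow> Ck_on k g S \<Longrightarrow> Ck_on k (\<lambda>x. f x + g x) S"
proof (induction k arbitrary: f g)
  case 0
  then show ?case by (auto intro: continuous_intros)
next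
  case (Suc k)
  show ?case
  proof (rule Ck_on_SucI[OF assms])
    show "((\<lambda>x. f x + g x) has_derivative
        (\<lambda>v. frechet_derivative f (at x) v + frechet_derivative g (at x) v)) (at x)" if "x \<in> S" for x
      using Suc.prems that by (intro has_derivative_add Ck_on_SucD) auto
    show "Ck_on k (\<lambda>x. frechet_derivative f (at x) v + frechet_derivative g (at x) v) S" for v
      using Suc by simp
  qed
qed

lemma Ck_on_bilinear:
  assumes "open S" "bounded_bilinear B"
  shows "Ck_on k f S \<Longrightarrow> Ck_on k g S \<Longrightarrow> Ck_on k (\<lambda>x. B (f x) (g x)) S"
proof (induction k arbitrary: f g)
  case 0
  then show ?case by (auto intro: bounded_bilinear.continuous_on[OF assms(2)])
next
  case (Suc k)
  show ?case
  proof (rule Ck_on_SucI[OF assms(1)])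
    show "((\<lambda>x. B (f x) (g x)) has_derivative
        (\<lambda>v. B (f x) (frechet_derivative g (at x) v) + B (frechet_derivative f (at x) v) (g x)))
        (at x)" if "x \<in> S" for x
      using Suc.prems that by (intro bounded_bilinear.FDERIV[OF assms(2)] Ck_on_SucD) auto
    have "Ck_on k f S" "Ck_on k g S"
      using Suc.prems by (auto intro: Ck_on_Suc_imp simp del: Ck_on.simps)
    then show "Ck_on k (\<lambda>x. B (f x) (frechet_derivative g (at x) v)
        + B (frechet_derivative f (at x) v) (g x)) S" for v
      using Suc.prems by (intro Ck_on_add[OF assms(1)] Suc.IH) auto
  qed
qed

lemma Ck_on_inverse:
  fixes f :: "'a::euclidean_space \<Rightarrow> real"
  assumes "open S" "\<And>x. x \<in> S \<Longrightarrow> f x \<noteq> 0"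
  shows "Ck_on k f S \<Longrightarrow> Ck_on k (\<lambda>x. inverse (f x)) S"
proof (induction k)
  case 0
  then show ?case using assms(2) by (auto intro: continuous_on_inverse)
next
  case (Suc k)
  show ?case
  proof (rule Ck_on_SucI[OF assms(1)])
    show "((\<lambda>x. inverse (f x)) has_derivative
        (\<lambda>v. - (inverse (f x) * frechet_derivative f (at x) v * inverse (f x)))) (at x)"
      if "x \<in> S" for x
      using assms(2) Suc.prems that by (intro Deriv.has_derivative_inverse Ck_on_SucD) auto
    have I: "Ck_on k (\<lambda>x. inverse (f x)) S"
      using Suc.prems by (intro Suc.IH) (auto intro: Ck_on_Suc_imp simp del: Ck_on.simps)
    note mult = Ck_on_bilinear[OF assms(1) bounded_bilinear_mult]
    have "Ck_on k (\<lambda>x. (-1) * (inverse (f x) * frechet_derivative f (at x) v * inverse (f x))) S" for v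
      using Suc.prems by (intro mult I Ck_on_const[OF assms(1)]) auto
    then show "Ck_on k (\<lambda>x. - (inverse (f x) * frechet_derivative f (at x) v * inverse (f x))) S" for v
      by simp
  qed
qed

lemma smooth_on_open_const: "open S \<Longrightarrow> smooth_on_open (\<lambda>_. c) S"
  by (simp add: smooth_on_open_def Ck_on_const)

lemma smooth_on_open_bounded_linear: "bounded_linear f \<Longrightarrow> open S \<Longrightarrow> smooth_on_open f S"
  by (simp add: smooth_on_open_def Ck_on_bounded_linear)

lemma smooth_on_open_add:
  "open S \<Longrightarrow> smooth_on_open f S \<Longrightarrow> smooth_on_open g S \<Longrightarrow> smooth_on_open (\<lambda>x. f x + g x) S"
  by (simp add: smooth_on_open_def Ck_on_add)

lemma smooth_on_open_bilinear:
  "bounded_bilinear B \<Longrightarrow> open S \<Longrightarrow> smooth_on_open f S \<Longrightarrow> smooth_on_open g S \<Longrightarrow>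
    smooth_on_open (\<lambda>x. B (f x) (g x)) S"
  by (simp add: smooth_on_open_def Ck_on_bilinear)

lemmas smooth_on_open_mult = smooth_on_open_bilinear[OF bounded_bilinear_mult]
lemmas smooth_on_open_scaleR = smooth_on_open_bilinear[OF bounded_bilinear_scaleR]
lemmas smooth_on_open_inner = smooth_on_open_bilinear[OF bounded_bilinear_inner]

lemma smooth_on_open_inverse:
  fixes f :: "'a::euclidean_space \<Rightarrow> real"
  shows "open S \<Longrightarrow> (\<And>x. x \<in> S \<Longrightarrow> f x \<noteq> 0) \<Longrightarrow> smooth_on_open f S \<Longrightarrow>
    smooth_on_open (\<lambda>x. inverse (f x)) S"
  by (simp add: smooth_on_open_def Ck_on_inverse)

lemma smooth_on_open_diff:
  assumes "open S" "smooth_on_open f S" "smooth_on_open g S"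
  shows "smooth_on_open (\<lambda>x. f x - g x) S"
proof -
  have "smooth_on_open (\<lambda>x. f x + (-1) *\<^sub>R g x) S"
    by (intro smooth_on_open_add smooth_on_open_scaleR smooth_on_open_const assms)
  then show ?thesis by simp
qed

lemma smooth_on_open_power:
  fixes f :: "'a::euclidean_space \<Rightarrow> real"
  assumes "open S" "smooth_on_open f S"
  shows "smooth_on_open (\<lambda>x. f x ^ m) S"
  by (induction m) (auto intro: smooth_on_open_const smooth_on_open_mult assms)

lemma smooth_on_open_sum:
  assumes "open S" "\<And>i. i \<in> I \<Longrightarrow> smooth_on_open (f i) S"
  shows "smooth_on_open (\<lambda>x. \<Sum>i\<in>I. f i x) S"
  using assms(2)
  by (induction I rule: infinite_finite_induct)
    (auto intro: smooth_on_open_const smooth_on_open_add assms(1))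

lemma smooth_on_open_vec_nth: "open S \<Longrightarrow> smooth_on_open (\<lambda>x. x $ i) S"
  by (intro smooth_on_open_bounded_linear bounded_linear_vec_nth)

text \<open>
  A derivative of such a curve is again of this form, with other vectors, so the induction on
  the order has to range over all pairs of vectors.
\<close>

lemma smooth_on_open_great_circle:
  fixes x v :: "'a::euclidean_space"
  assumes "open S"
  shows "smooth_on_open (\<lambda>t. cos t *\<^sub>R x + sin t *\<^sub>R v) S"
proof -
  have "Ck_on k (\<lambda>t. cos t *\<^sub>R x + sin t *\<^sub>R v) S" for k
  proof (induction k arbitrary: x v)
    case 0
    then show ?case by (auto intro!: continuous_intros)
  next
    case (Suc k)
    show ?case
    proof (rule Ck_on_SucI[OF assms])
      show "((\<lambda>t. cos t *\<^sub>R x + sin t *\<^sub>R v) has_derivative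
          (\<lambda>h. cos t *\<^sub>R (h *\<^sub>R v) + sin t *\<^sub>R (- h *\<^sub>R x))) (at t)" for t
        by (auto intro!: derivative_eq_intros simp: algebra_simps)
      show "Ck_on k (\<lambda>t. cos t *\<^sub>R (h *\<^sub>R v) + sin t *\<^sub>R (- h *\<^sub>R x)) S" for h
        by (rule Suc)
    qed
  qed
  then show ?thesis by (simp add: smooth_on_open_def)
qed

section \<open>Spheres and their critical points\<close>

text \<open>
  Curves in the sphere have velocities orthogonal to their base point, because their squared norm
  is constant; conversely every unit vector orthogonal to \<open>x\<close> is the velocity of a
  great circle through \<open>x\<close>.  Hence criticality is a condition on the ambient derivative.
\<close>

lemma critical_points_sphere:
  fixes f :: "'a::euclidean_space \<Rightarrow> real"
  assumes f: "\<And>x. (f has_derivative D x) (at x)"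
  shows "critical_points f (sphere 0 1) =
    {x. norm x = 1 \<and> (\<forall>h. x \<bullet> h = 0 \<longrightarrow> D x h = 0)}" (is "?L = ?R")
proof (intro set_eqI iffI)
  fix x assume x: "x \<in> ?L"
  then have nx: "norm x = 1" by (simp add: critical_points_def)
  interpret D: bounded_linear "D x" using f by (rule has_derivative_bounded_linear)
  have "D x h = 0" if xh: "x \<bullet> h = 0" for h
  proof (cases "h = 0")
    case True then show ?thesis by (simp add: D.zero)
  next
    case False
    \<comment> \<open>A great circle needs unit speed to stay on the sphere; linearity rescales.\<close>
    define u where "u = h /\<^sub>R norm h"
    have "norm u = 1" using False by (simp add: u_def)
    then have u: "u \<bullet> u = 1" "x \<bullet> u = 0" "u \<bullet> x = 0" "x \<bullet> x = 1"
      using xh nx by (simp_all only: norm_eq_1) (simp_all add: u_def inner_commute)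
    define \<gamma> where "\<gamma> = (\<lambda>t::real. cos t *\<^sub>R x + sin t *\<^sub>R u)"
    have "norm (\<gamma> t) = 1" for t
    proof -
      have "\<gamma> t \<bullet> \<gamma> t = (cos t)\<^sup>2 + (sin t)\<^sup>2"
        using u unfolding \<gamma>_def
        by (simp add: inner_add_left inner_add_right power2_eq_square)
      then show ?thesis by (simp add: norm_eq_1)
    qed
    then have "\<gamma> ` {-1<..<1} \<subseteq> sphere 0 1" by auto
    moreover have "smooth_on_open \<gamma> {-1<..<1}"
      unfolding \<gamma>_def by (rule smooth_on_open_great_circle) simp
    moreover have "\<gamma> 0 = x" by (simp add: \<gamma>_def)
    ultimately have "((f \<circ> \<gamma>) has_real_derivative 0) (at 0)"
      using x unfolding critical_points_def
      by (auto dest!: spec[of _ "1::real"] spec[of _ \<gamma>])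
    moreover have "((f \<circ> \<gamma>) has_real_derivative D x u) (at 0)"
    proof -
      have "(\<gamma> has_derivative (\<lambda>h. h *\<^sub>R u)) (at 0)"
        unfolding \<gamma>_def by (auto intro!: derivative_eq_intros)
      then have "((f \<circ> \<gamma>) has_derivative (D x \<circ> (\<lambda>h. h *\<^sub>R u))) (at 0)"
        by (intro diff_chain_at) (use f \<open>\<gamma> 0 = x\<close> in auto)
      then show ?thesis
        unfolding has_field_derivative_def
        by (simp add: D.scaleR o_def mult_commute_abs)
    qed
    ultimately have "D x u = 0" by (rule DERIV_unique[symmetric])
    then show ?thesis using False by (simp add: u_def D.scaleR)
  qed
  with nx show "x \<in> ?R" by simp
next
  fix x assume x: "x \<in> ?R"
  have "((f \<circ> \<gamma>) has_real_derivative 0) (at 0)"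
    if e: "e > 0" and \<gamma>: "smooth_on_open \<gamma> {-e<..<e}" "\<gamma> ` {-e<..<e} \<subseteq> sphere 0 1" "\<gamma> 0 = x"
    for e :: real and \<gamma>
  proof -
    define g where "g = frechet_derivative \<gamma> (at 0)"
    have g: "(\<gamma> has_derivative g) (at 0)"
      using \<gamma>(1) e unfolding smooth_on_open_def g_def
      by (intro Ck_on_SucD[of 0 _ "{-e<..<e}"]) auto
    interpret g: bounded_linear g using g by (rule has_derivative_bounded_linear)
    have "((\<lambda>t. \<gamma> t \<bullet> \<gamma> t) has_derivative (\<lambda>h. x \<bullet> g h + g h \<bullet> x)) (at 0)"
      using has_derivative_inner[OF g g] \<gamma>(3) by simp
    moreover have "((\<lambda>t. \<gamma> t \<bullet> \<gamma> t) has_derivative (\<lambda>h. 0)) (at 0)"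
    proof (rule has_derivative_transform_within_open[OF has_derivative_const])
      show "1 = \<gamma> t \<bullet> \<gamma> t" if "t \<in> {-e<..<e}" for t
        using \<gamma>(2) that by (force simp: norm_eq_1[symmetric])
    qed (use e in auto)
    ultimately have "(\<lambda>h. x \<bullet> g h + g h \<bullet> x) = (\<lambda>h. 0)"
      by (rule has_derivative_unique)
    then have "x \<bullet> g h = 0" for h
      by (auto dest!: fun_cong[of _ _ h] simp: inner_commute)
    with x have "D x (g h) = 0" for h by simp
    moreover have "((f \<circ> \<gamma>) has_derivative (D x \<circ> g)) (at 0)"
      by (intro diff_chain_at g) (use f \<gamma>(3) in auto)
    ultimately show ?thesis
      unfolding has_field_derivative_def by (simp add: o_def lambda_zero)
  qed
  with x show "x \<in> ?L" by (auto simp: critical_points_def)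
qed

text \<open>
  The inversion in the sphere of radius \<open>sqrt 2\<close> centred at \<open>- x\<close>.  For a unit vector
  \<open>x\<close> it is stereographic projection from \<open>- x\<close> on the unit sphere, extended to an
  involution of the punctured ambient space.
\<close>

definition inversion :: "'a::euclidean_space \<Rightarrow> 'a \<Rightarrow> 'a" where
  "inversion x y = (2 * inverse ((y + x) \<bullet> (y + x))) *\<^sub>R (y + x) - x"

lemma inversion_inversion:
  assumes "y \<noteq> - x"
  shows "inversion x y \<noteq> - x" "inversion x (inversion x y) = y"
proof -
  define z where "z = y + x"
  have z: "z \<noteq> 0" using assms by (auto simp: z_def eq_neg_iff_add_eq_0)
  show "inversion x y \<noteq> - x"
    using z by (simp add: inversion_def z_def[symmetric])
  show "inversion x (inversion x y) = y"
    using z by (simp add: inversion_def flip: z_def) (simp add: z_def field_simps)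
qed

lemma inversion_inner_centre:
  assumes "norm x = 1" "y \<noteq> - x"
  shows "x \<bullet> inversion x y = 0 \<longleftrightarrow> norm y = 1"
proof -
  have xx: "x \<bullet> x = 1" using assms by (simp add: norm_eq_1)
  have "y + x \<noteq> 0" using assms(2) by (simp add: eq_neg_iff_add_eq_0)
  then have ne: "(y + x) \<bullet> (y + x) \<noteq> 0" by simp
  have eq: "(y + x) \<bullet> (y + x) = y \<bullet> y + 2 * (x \<bullet> y) + 1"
    by (simp add: inner_add_left inner_add_right xx inner_commute)
  have "x \<bullet> inversion x y = 2 * inverse ((y + x) \<bullet> (y + x)) * (x \<bullet> y + 1) - 1"
    by (simp add: inversion_def inner_diff_right inner_add_right xx)
  also have "\<dots> = (1 - y \<bullet> y) / ((y + x) \<bullet> (y + x))"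
    using ne by (simp add: divide_simps) (simp add: eq)
  finally show ?thesis using ne by (auto simp: norm_eq_1)
qed

lemma inversion_in_subspace:
  assumes "subspace L" "x \<in> L" "y \<in> L"
  shows "inversion x y \<in> L"
  unfolding inversion_def using assms by (intro subspace_diff subspace_scale subspace_add)

lemma smooth_inversion: "smooth_on_open (inversion x) (- {- x})"
proof -
  have lin: "smooth_on_open (\<lambda>y. y + x) (- {- x})"
    by (intro smooth_on_open_add smooth_on_open_const smooth_on_open_bounded_linear) auto
  have "smooth_on_open
      (\<lambda>y. (2 * inverse ((y + x) \<bullet> (y + x))) *\<^sub>R (y + x) - x) (- {- x})"
    by (intro smooth_on_open_diff smooth_on_open_scaleR smooth_on_open_mult smooth_on_open_const
        smooth_on_open_inverse smooth_on_open_inner lin) (auto simp: eq_neg_iff_add_eq_0)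
  then show ?thesis by (simp add: inversion_def[abs_def])
qed

text \<open>
  Inversion centred at the antipode of \<open>x\<close> preserves \<open>L\<close> and exchanges the unit sphere
  with the hyperplane orthogonal to \<open>x\<close>.  Being its own inverse it is a slice chart that
  covers everything except the antipode.
\<close>

lemma smooth_submanifold_great_sphere:
  fixes L :: "'a::euclidean_space set"
  assumes L: "subspace L"
  shows "smooth_submanifold (dim L - 1) (sphere 0 1 \<inter> L)"
  unfolding smooth_submanifold_def
proof
  fix x :: 'a assume x: "x \<in> sphere 0 1 \<inter> L"
  then have nx: "norm x = 1" and xL: "x \<in> L" by auto
  define U where "U = - {- x}"
  define T where "T = {v \<in> L. \<forall>u \<in> span {x}. orthogonal u v}"
  have T: "v \<in> T \<longleftrightarrow> v \<in> L \<and> x \<bullet> v = 0" for v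
    unfolding T_def by (auto simp: orthogonal_def span_singleton)
  have subT: "subspace T"
    using L by (auto simp: subspace_def T inner_add_right)
  have "span {x} \<subseteq> L" using L xL by (simp add: span_minimal)
  then have "dim T + dim (span {x}) = dim L"
    unfolding T_def using L by (intro dim_subspace_orthogonal_to_vectors subspace_span)
  moreover have "dim (span {x}) = 1"
    using nx by (auto simp: dim_singleton)
  ultimately have dimT: "dim T = dim L - 1" by simp
  have inv: "inversion x y \<in> U" "inversion x (inversion x y) = y" if "y \<in> U" for y
    using inversion_inversion[of y x] that by (auto simp: U_def)
  have cont: "continuous_on U (inversion x)"
    using smooth_inversion[of x] unfolding smooth_on_open_def U_def by (metis Ck_on.simps(1))
  have hom: "homeomorphism U U (inversion x) (inversion x)"
    by (rule homeomorphismI) (use inv cont in auto)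
  have mem: "inversion x y \<in> T \<longleftrightarrow> y \<in> sphere 0 1 \<inter> L" if "y \<in> U" for y
  proof -
    have "inversion x y \<in> L \<longleftrightarrow> y \<in> L"
      using inversion_in_subspace[OF L xL] inv(2)[OF that] by metis
    then show ?thesis
      using inversion_inner_centre[OF nx, of y] that by (auto simp: T U_def)
  qed
  have image: "inversion x ` (sphere 0 1 \<inter> L \<inter> U) = T \<inter> U"
  proof (intro subset_antisym subsetI)
    fix y assume "y \<in> T \<inter> U"
    with mem[OF inv(1), of y] inv[of y] show "y \<in> inversion x ` (sphere 0 1 \<inter> L \<inter> U)"
      by (metis IntD1 IntD2 IntI imageI)
  qed (use mem inv in auto)
  have xU: "x \<in> U"
    using nx by (auto simp: U_def eq_neg_iff_add_eq_0 simp flip: scaleR_2)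
  show "\<exists>U V \<phi> \<psi> L'. open U \<and> open V \<and> x \<in> U \<and> homeomorphism U V \<phi> \<psi> \<and>
      smooth_on_open \<phi> U \<and> smooth_on_open \<psi> V \<and> subspace L' \<and> dim L' = dim L - 1 \<and>
      \<phi> ` (sphere 0 1 \<inter> L \<inter> U) = L' \<inter> (V :: 'a set)"
    by (rule exI[of _ U], rule exI[of _ U], rule exI[of _ "inversion x"],
        rule exI[of _ "inversion x"], rule exI[of _ T])
      (use image xU hom subT dimT smooth_inversion[of x] in \<open>auto simp: U_def\<close>)
qed

lemma great_sphere_homeomorphic:
  fixes L :: "'a::euclidean_space set"
  assumes L: "subspace L" and dimL: "dim L = DIM('b::euclidean_space)"
  shows "(sphere 0 1 \<inter> L) homeomorphic (sphere 0 1 :: 'b set)"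
proof -
  have "dim L = dim (UNIV :: 'b set)" using dimL by simp
  then obtain f and g :: "'b \<Rightarrow> 'a" where fg: "linear f" "linear g" "f ` L = UNIV" "g ` UNIV = L"
      "\<And>x. x \<in> L \<Longrightarrow> norm (f x) = norm x" "\<And>x. norm (g x) = norm x"
      "\<And>x. x \<in> L \<Longrightarrow> g (f x) = x" "\<And>x. f (g x) = x"
    using isometries_subspaces[OF L subspace_UNIV] by auto
  have "homeomorphism (sphere 0 1 \<inter> L) (sphere 0 1) f g"
  proof (rule homeomorphismI)
    show "continuous_on (sphere 0 1 \<inter> L) f" "continuous_on (sphere 0 1) g"
      using fg(1,2) by (auto intro: linear_continuous_on simp: linear_linear)
  qed (use fg in auto)
  then show ?thesis unfolding homeomorphic_def by blast
qed

text \<open>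
  Once the critical set is a finite union of great circles in planes that meet only in the origin,
  the geometric requirements on a \<open>P\<close>-function hold automatically: the circles are disjoint
  compact sets, and each is open in their finite union as the complement of the others.
\<close>

lemma P_function_great_circles:
  fixes f :: "'a::euclidean_space \<Rightarrow> real"
  assumes f: "smooth_on_open f UNIV" and fin: "finite \<L>"
    and L: "\<And>L. L \<in> \<L> \<Longrightarrow> subspace L \<and> dim L = 2"
    and triv: "\<And>L M. L \<in> \<L> \<Longrightarrow> M \<in> \<L> \<Longrightarrow> L \<noteq> M \<Longrightarrow> L \<inter> M \<subseteq> {0}"
    and crit: "critical_points f (sphere 0 1) = sphere 0 1 \<inter> \<Union>\<L>"
  shows "P_function (sphere 0 1 :: (real ^ 2) set) (sphere 0 1) f ((\<inter>) (sphere 0 1) ` \<L>)"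
  unfolding P_function_def
proof (intro conjI ballI)
  let ?S = "sphere 0 1 :: 'a set" and ?\<C> = "(\<inter>) (sphere 0 1) ` \<L>"
  have sphere: "\<exists>d. smooth_submanifold d (sphere 0 1 :: 'c::euclidean_space set)"
    using smooth_submanifold_great_sphere[OF subspace_UNIV] by auto
  show "\<exists>d. smooth_submanifold d (sphere 0 1 :: (real ^ 2) set)" "\<exists>d. smooth_submanifold d ?S"
    by (fact sphere)+
  show "smooth_map_on f ?S"
    unfolding smooth_map_on_def using f by (intro ballI exI[of _ UNIV] exI[of _ f]) auto
  have hom: "C homeomorphic (sphere 0 1 :: (real ^ 2) set)" if "C \<in> ?\<C>" for C
    using that L great_sphere_homeomorphic[where 'b = "real ^ 2"] by force
  then show "C homeomorphic (sphere 0 1 :: (real ^ 2) set)" if "C \<in> ?\<C>" for C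
    using that .
  have disj: "pairwise disjnt ?\<C>"
  proof (rule pairwiseI)
    fix C C' assume "C \<in> ?\<C>" "C' \<in> ?\<C>" "C \<noteq> C'"
    then obtain L M where "L \<in> \<L>" "M \<in> \<L>" "L \<noteq> M" "C = ?S \<inter> L" "C' = ?S \<inter> M" by blast
    with triv[of L M] show "disjnt C C'" by (auto simp: disjnt_def)
  qed
  have isolate: "C = \<Union>\<A> - \<Union>(\<A> - {C})" if "pairwise disjnt \<A>" "C \<in> \<A>" for \<A> and C :: "'a set"
    using that by (auto simp: pairwise_def disjnt_iff)
  show "critical_submanifolds f ?S ?\<C>"
    unfolding critical_submanifolds_def
  proof (intro conjI ballI disj)
    show union: "\<Union> ?\<C> = critical_points f ?S" using crit by auto
    fix C assume C: "C \<in> ?\<C>"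
    then obtain M where M: "M \<in> \<L>" "C = ?S \<inter> M" by auto
    show "C \<noteq> {}"
      using hom[OF C] homeomorphic_empty(2)[of "sphere 0 1 :: (real ^ 2) set"]
      by (auto simp: sphere_eq_empty)
    have "closed C'" if "C' \<in> ?\<C>" for C'
      using that L by (metis imageE closed_Int closed_sphere closed_subspace)
    then have "closed (\<Union> (?\<C> - {C}))"
      using fin by (intro closed_Union) auto
    moreover have "C = critical_points f ?S - \<Union> (?\<C> - {C})"
      unfolding union[symmetric] by (rule isolate[OF disj C])
    ultimately show "openin (top_of_set (critical_points f ?S)) C"
      by (metis Diff_eq open_Compl openin_open)
    show "\<exists>d. smooth_submanifold d C"
      using M L smooth_submanifold_great_sphere by blast
  qed
qed

section \<open>Adding critical circles by heavily weighted squares\<close>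

definition coord_restrict :: "'n set \<Rightarrow> real ^ 'n \<Rightarrow> real ^ 'n::finite" where
  "coord_restrict C x = (\<chi> i. if i \<in> C then x $ i else 0)"

definition coord_subspace :: "'n set \<Rightarrow> (real ^ 'n::finite) set" where
  "coord_subspace I = {x. \<forall>i. i \<notin> I \<longrightarrow> x $ i = 0}"

lemma coord_restrict_eq_0: "coord_restrict C x = 0 \<longleftrightarrow> x \<in> coord_subspace (- C)"
  by (auto simp: coord_restrict_def coord_subspace_def vec_eq_iff)

lemma inner_coord_restrict: "x \<bullet> coord_restrict C x = coord_restrict C x \<bullet> coord_restrict C x"
  unfolding inner_vec_def by (intro sum.cong) (auto simp: coord_restrict_def)

lemma subspace_coord_subspace: "subspace (coord_subspace I)"
  by (auto simp: coord_subspace_def subspace_def)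

lemma dim_coord_subspace: "dim (coord_subspace I) = card I"
  unfolding coord_subspace_def dim_vec_eq[symmetric] by (rule dim_substandard_cart)

lemma coord_subspace_Int: "coord_subspace I \<inter> coord_subspace J = coord_subspace (I \<inter> J)"
  by (auto simp: coord_subspace_def)

lemma coord_subspace_empty: "coord_subspace {} = {0}"
  by (auto simp: coord_subspace_def vec_eq_iff)

text \<open>
  The sphere is a join of the unit spheres of the coordinate spaces of \<open>C\<close> and of its complement.
  Let \<open>r\<close> be the \<open>C\<close>-part of a critical point \<open>x\<close>.  If \<open>r = 0\<close>, testing with the
  infinitesimal rotations in two further coordinates shows that all nonzero coordinates of \<open>x\<close>
  have the same weight.  If \<open>r \<noteq> 0\<close>, testing with the rotation that trades \<open>r\<close>
  against a further coordinate \<open>i\<close> compares the growth of \<open>F\<close> along \<open>r\<close> with the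
  weight of \<open>i\<close>; as the weight is the larger of the two, the coordinate vanishes.  So
  no critical point lies strictly between the two parts of the join.
\<close>

lemma critical_points_add_weighted_squares:
  fixes F :: "real ^ 'n::finite \<Rightarrow> real"
  assumes F: "\<And>x. (F has_derivative D x) (at x)"
    and wC: "\<And>i. i \<in> C \<Longrightarrow> w i = 0"
    and indep: "\<And>x i. i \<notin> C \<Longrightarrow> D x (axis i 1) = 0"
    and zero: "\<And>x h. x \<in> coord_subspace (- C) \<Longrightarrow> D x h = 0"
    and dom: "\<And>x i. norm x = 1 \<Longrightarrow> x \<notin> coord_subspace (- C) \<Longrightarrow> i \<notin> C \<Longrightarrow>
      D x (coord_restrict C x) < 2 * w i * (coord_restrict C x \<bullet> coord_restrict C x)"
  shows "critical_points (\<lambda>x. F x + (\<Sum>i\<in>UNIV. w i * (x $ i)\<^sup>2)) (sphere 0 1) =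
    sphere 0 1 \<inter> (\<Union>\<omega>\<in>w ` (- C). coord_subspace {i. i \<notin> C \<and> w i = \<omega>}) \<union>
    {x \<in> coord_subspace C. norm x = 1 \<and> (\<forall>h. x \<bullet> h = 0 \<longrightarrow> D x h = 0)}"
    (is "?L = ?A \<union> ?B")
proof -
  define q where "q = (\<lambda>x h :: real ^ 'n. \<Sum>i\<in>UNIV. w i * x $ i * h $ i)"
  have lin: "bounded_linear (D x)" for x using F by (rule has_derivative_bounded_linear)
  have qdiff: "q x (h - k) = q x h - q x k" for x h k
    by (simp add: q_def right_diff_distrib sum_subtractf)
  have qscale: "q x (c *\<^sub>R h) = c * q x h" for x h c
    by (simp add: q_def sum_distrib_left mult.left_commute)
  have qaxis: "q x (axis i 1) = w i * x $ i" for x i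
    by (simp add: q_def axis_def if_distrib cong: if_cong)
  have qC: "q x (coord_restrict C x) = 0" for x
    unfolding q_def by (intro sum.neutral) (auto simp: coord_restrict_def wC)
  have xaxis: "x \<bullet> axis i 1 = x $ i" for x :: "real ^ 'n" and i
    by (simp add: inner_axis)
  have "((\<lambda>x. F x + (\<Sum>i\<in>UNIV. w i * (x $ i)\<^sup>2)) has_derivative (\<lambda>h. D x h + 2 * q x h)) (at x)" for x
    unfolding q_def
    by (auto intro!: derivative_eq_intros F bounded_linear.has_derivative[OF bounded_linear_vec_nth]
        simp: sum_distrib_left fun_eq_iff intro!: sum.cong)
  then have L: "?L = {x. norm x = 1 \<and> (\<forall>h. x \<bullet> h = 0 \<longrightarrow> D x h + 2 * q x h = 0)}"
    by (rule critical_points_sphere)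
  show ?thesis
  proof (intro subset_antisym subsetI)
    fix x assume "x \<in> ?L"
    then have nx: "norm x = 1" and crit: "\<And>h. x \<bullet> h = 0 \<Longrightarrow> D x h + 2 * q x h = 0"
      by (auto simp: L)
    show "x \<in> ?A \<union> ?B"
    proof (cases "x \<in> coord_subspace (- C)")
      case True
      obtain i where i: "x $ i \<noteq> 0" using nx by (metis norm_zero vec_eq_iff zero_index zero_neq_one)
      then have iC: "i \<notin> C" using True by (auto simp: coord_subspace_def)
      have "x $ j = 0" if "w j \<noteq> w i" for j
      proof -
        \<comment> \<open>Rotation in the plane of the coordinates \<open>i\<close> and \<open>j\<close>.\<close>
        have "x \<bullet> (x $ j *\<^sub>R axis i 1 - x $ i *\<^sub>R axis j 1) = 0"
          by (simp add: inner_diff_right xaxis)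
        from crit[OF this] zero[OF True]
        have "(w i - w j) * x $ i * x $ j = 0"
          by (simp add: qdiff qscale qaxis algebra_simps)
        with that i show ?thesis by auto
      qed
      then have "x \<in> coord_subspace {j. j \<notin> C \<and> w j = w i}"
        using True by (auto simp: coord_subspace_def)
      with nx iC show ?thesis by auto
    next
      case False
      define r where "r = coord_restrict C x"
      have "x $ i = 0" if "i \<notin> C" for i
      proof -
        \<comment> \<open>Rotation in the plane spanned by \<open>r\<close> and the coordinate \<open>i\<close>.\<close>
        have "x \<bullet> ((r \<bullet> r) *\<^sub>R axis i 1 - x $ i *\<^sub>R r) = 0"
          by (simp add: inner_diff_right xaxis r_def inner_coord_restrict)
        from crit[OF this]
        have "D x ((r \<bullet> r) *\<^sub>R axis i 1 - x $ i *\<^sub>R r) + 2 * (r \<bullet> r) * w i * x $ i = 0"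
          by (simp add: qdiff qscale qaxis) (simp add: r_def qC)
        moreover have "D x ((r \<bullet> r) *\<^sub>R axis i 1 - x $ i *\<^sub>R r) = - x $ i * D x r"
          using indep[OF that]
          by (simp add: linear_diff linear_scale bounded_linear.linear[OF lin])
        ultimately have "x $ i * (2 * w i * (r \<bullet> r) - D x r) = 0"
          by (simp add: algebra_simps)
        with dom[OF nx False that] show ?thesis by (simp add: r_def)
      qed
      then have xC: "x \<in> coord_subspace C" by (auto simp: coord_subspace_def)
      then have "q x h = 0" for h
        unfolding q_def by (intro sum.neutral) (auto simp: coord_subspace_def dest: wC)
      with crit nx xC show ?thesis by simp
    qed
  next
    fix x assume "x \<in> ?A \<union> ?B"
    then show "x \<in> ?L"
    proof
      assume "x \<in> ?A"
      then obtain \<omega> where nx: "norm x = 1" and x: "x \<in> coord_subspace {i. i \<notin> C \<and> w i = \<omega>}"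
        by auto
      have "x \<in> coord_subspace (- C)" using x by (auto simp: coord_subspace_def)
      moreover have "q x h = \<omega> * (x \<bullet> h)" for h
        unfolding q_def inner_vec_def sum_distrib_left
        by (intro sum.cong) (use x in \<open>auto simp: coord_subspace_def\<close>)
      ultimately show ?thesis using nx zero by (simp add: L)
    next
      assume x: "x \<in> ?B"
      then have "q x h = 0" for h
        unfolding q_def by (intro sum.neutral) (auto simp: coord_subspace_def dest: wC)
      with x show ?thesis by (simp add: L)
    qed
  qed
qed

text \<open>
  Each weight is taken by exactly two coordinates, so that the corresponding critical sphere is a
  circle.
\<close>

lemma paired_weights:
  fixes C :: "'n::finite set"
  assumes "card (- C) = 2 * k"
  obtains w :: "'n \<Rightarrow> real"
  where "\<And>i. i \<in> C \<Longrightarrow> w i = 0" "\<And>i. i \<notin> C \<Longrightarrow> w i > M"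
    "\<And>i. i \<notin> C \<Longrightarrow> card {j. j \<notin> C \<and> w j = w i} = 2" "card (w ` (- C)) \<le> k"
proof -
  obtain g where g: "bij_betw g (- C) {0..<2 * k}"
    using ex_bij_betw_finite_nat[of "- C"] assms by auto
  define w where "w = (\<lambda>i. if i \<in> C then 0 else M + 1 + real (g i div 2))"
  have "card {j. j \<notin> C \<and> w j = w i} = 2" if i: "i \<notin> C" for i
  proof -
    define m where "m = g i div 2"
    have "g i < 2 * k" using g i by (auto simp: bij_betw_def)
    then have m: "m < k" by (auto simp: m_def)
    have "g ` {j. j \<notin> C \<and> w j = w i} = {2 * m, 2 * m + 1}"
    proof (intro subset_antisym subsetI)
      fix a assume "a \<in> g ` {j. j \<notin> C \<and> w j = w i}"
      then have "a div 2 = m" using i by (auto simp: w_def m_def)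
      then show "a \<in> {2 * m, 2 * m + 1}" by auto
    next
      fix a assume a: "a \<in> {2 * m, 2 * m + 1}"
      then have "a \<in> {0..<2 * k}" using m by auto
      then obtain j where "j \<notin> C" "a = g j" using g by (metis ComplD bij_betw_def imageE)
      moreover have "a div 2 = m" using a by auto
      ultimately show "a \<in> g ` {j. j \<notin> C \<and> w j = w i}"
        using i by (auto simp: w_def m_def)
    qed
    moreover have "inj_on g {j. j \<notin> C \<and> w j = w i}"
      using g by (auto simp: bij_betw_def inj_on_def)
    ultimately show ?thesis using card_image by fastforce
  qed
  moreover have "card (w ` (- C)) \<le> k"
  proof -
    have "g i div 2 < k" if "i \<notin> C" for i
      using bij_betwE[OF g] that by (metis ComplI atLeastLessThan_iff less_mult_imp_div_less mult.commute)
    then have "w ` (- C) \<subseteq> (\<lambda>m. M + 1 + real m) ` {..<k}"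
      by (auto simp: w_def)
    then have "card (w ` (- C)) \<le> card ((\<lambda>m. M + 1 + real m) ` {..<k})"
      by (intro card_mono) auto
    also have "\<dots> \<le> k" using card_image_le[of "{..<k}" "\<lambda>m. M + 1 + real m"] by simp
    finally show ?thesis .
  qed
  ultimately show thesis
    by (intro that[of w]) (auto simp: w_def)
qed

text \<open>
  The dimension induction in one step: a function on the sphere in the coordinates \<open>C\<close> whose
  critical set consists of great circles extends to a larger sphere at the price of one
  additional circle for every two additional coordinates.  The radial bound is what allows weights
  to dominate \<open>F\<close>.
\<close>

lemma P_function_join:
  fixes F :: "real ^ 'n::finite \<Rightarrow> real"
  assumes smooth: "smooth_on_open F UNIV"
    and F: "\<And>x. (F has_derivative D x) (at x)"
    and indep: "\<And>x i. i \<notin> C \<Longrightarrow> D x (axis i 1) = 0"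
    and zero: "\<And>x h. x \<in> coord_subspace (- C) \<Longrightarrow> D x h = 0"
    and bound: "\<And>x. norm x = 1 \<Longrightarrow>
      D x (coord_restrict C x) \<le> 2 * M * (coord_restrict C x \<bullet> coord_restrict C x)"
    and fin: "finite \<K>"
    and K: "\<And>L. L \<in> \<K> \<Longrightarrow> subspace L \<and> dim L = 2 \<and> L \<subseteq> coord_subspace C"
    and triv: "\<And>L L'. L \<in> \<K> \<Longrightarrow> L' \<in> \<K> \<Longrightarrow> L \<noteq> L' \<Longrightarrow> L \<inter> L' \<subseteq> {0}"
    and crit: "{x \<in> coord_subspace C. norm x = 1 \<and> (\<forall>h. x \<bullet> h = 0 \<longrightarrow> D x h = 0)} =
      sphere 0 1 \<inter> \<Union>\<K>"
    and k: "card (- C) = 2 * k"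
  shows "\<exists>(f :: real ^ 'n \<Rightarrow> real) \<C>.
    P_function (sphere 0 1 :: (real ^ 2) set) (sphere 0 1) f \<C> \<and>
    finite \<C> \<and> card \<C> \<le> k + card \<K>"
proof -
  \<comment> \<open>The coordinates outside \<open>C\<close> get weights above the radial growth rate of \<open>F\<close>.\<close>
  obtain w :: "'n \<Rightarrow> real" where w: "\<And>i. i \<in> C \<Longrightarrow> w i = 0" "\<And>i. i \<notin> C \<Longrightarrow> w i > M"
    "\<And>i. i \<notin> C \<Longrightarrow> card {j. j \<notin> C \<and> w j = w i} = 2" "card (w ` (- C)) \<le> k"
    using paired_weights[OF k, of M] by metis
  define E where "E = (\<lambda>\<omega>. coord_subspace {i. i \<notin> C \<and> w i = \<omega>})"
  define \<L> where "\<L> = E ` w ` (- C) \<union> \<K>"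
  define f where "f = (\<lambda>x. F x + (\<Sum>i\<in>UNIV. w i * (x $ i)\<^sup>2))"
  have E: "E \<omega> \<inter> E \<omega>' \<subseteq> {0}" if "\<omega> \<noteq> \<omega>'" for \<omega> \<omega>'
    unfolding E_def coord_subspace_Int using that
    by (auto simp: coord_subspace_def vec_eq_iff)
  have EC: "E \<omega> \<inter> coord_subspace C \<subseteq> {0}" for \<omega>
    unfolding E_def coord_subspace_Int by (auto simp: coord_subspace_def vec_eq_iff)
  have f: "smooth_on_open f UNIV"
    unfolding f_def
    by (intro smooth_on_open_add smooth_on_open_sum smooth_on_open_mult smooth_on_open_const
        smooth_on_open_power smooth_on_open_vec_nth smooth open_UNIV)
  have "critical_points f (sphere 0 1) = sphere 0 1 \<inter> \<Union>(E ` w ` (- C)) \<union> sphere 0 1 \<inter> \<Union>\<K>"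
    unfolding f_def E_def crit[symmetric]
  proof (rule critical_points_add_weighted_squares[OF F w(1) indep zero])
    fix x :: "real ^ 'n" and i
    assume x: "norm x = 1" "x \<notin> coord_subspace (- C)" and i: "i \<notin> C"
    let ?r = "coord_restrict C x"
    have "?r \<bullet> ?r > 0" using x(2) by (simp add: coord_restrict_eq_0)
    then have "2 * M * (?r \<bullet> ?r) < 2 * w i * (?r \<bullet> ?r)" using w(2)[OF i] by simp
    with bound[OF x(1)] show "D x ?r < 2 * w i * (?r \<bullet> ?r)" by linarith
  qed
  then have crit': "critical_points f (sphere 0 1) = sphere 0 1 \<inter> \<Union>\<L>"
    by (auto simp: \<L>_def)
  have "P_function (sphere 0 1 :: (real ^ 2) set) (sphere 0 1) f ((\<inter>) (sphere 0 1) ` \<L>)"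
  proof (rule P_function_great_circles[OF f _ _ _ crit'])
    show "finite \<L>" using fin by (simp add: \<L>_def)
    show "subspace L \<and> dim L = 2" if "L \<in> \<L>" for L
      using that K w(3) by (auto simp: \<L>_def E_def subspace_coord_subspace dim_coord_subspace)
    show "L \<inter> L' \<subseteq> {0}" if "L \<in> \<L>" "L' \<in> \<L>" "L \<noteq> L'" for L L'
      using that unfolding \<L>_def
    proof (elim UnE)
      assume "L \<in> E ` w ` (- C)" "L' \<in> E ` w ` (- C)"
      then obtain \<omega> \<omega>' where "L = E \<omega>" "L' = E \<omega>'" by auto
      with that(3) E[of \<omega> \<omega>'] show ?thesis by auto
    next
      assume "L \<in> E ` w ` (- C)" "L' \<in> \<K>"
      then obtain \<omega> where "L = E \<omega>" "L' \<subseteq> coord_subspace C" using K by auto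
      with EC[of \<omega>] show ?thesis by auto
    next
      assume "L \<in> \<K>" "L' \<in> E ` w ` (- C)"
      then obtain \<omega> where "L' = E \<omega>" "L \<subseteq> coord_subspace C" using K by auto
      with EC[of \<omega>] show ?thesis by auto
    next
      assume "L \<in> \<K>" "L' \<in> \<K>"
      with that(3) show ?thesis by (intro triv)
    qed
  qed
  moreover have "card ((\<inter>) (sphere 0 1) ` \<L>) \<le> k + card \<K>"
  proof -
    have "card ((\<inter>) (sphere 0 1) ` \<L>) \<le> card \<L>"
      using fin by (intro card_image_le) (simp add: \<L>_def)
    also have "\<dots> \<le> card (E ` w ` (- C)) + card \<K>" unfolding \<L>_def by (rule card_Un_le)
    also have "card (E ` w ` (- C)) \<le> card (w ` (- C))" by (intro card_image_le) simp
    finally show ?thesis using w(4) by simp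
  qed
  moreover have "finite ((\<inter>) (sphere 0 1) ` \<L>)" using fin by (simp add: \<L>_def)
  ultimately show ?thesis by blast
qed

section \<open>Merging two critical points into a circle on the four-sphere\<close>

text \<open>
  With \<open>p = \<bar>z\<bar>\<^sup>2\<close>, \<open>q = \<bar>w\<bar>\<^sup>2\<close> for
  \<open>z = (x, y)\<close>, \<open>w = (u, v)\<close>, this is the quadratic form \<open>q - p\<close>
  times a nonnegative factor.  The last bracket is
  \<open>(x - u)\<^sup>2 + y\<^sup>2 + v\<^sup>2\<close>, so the factor vanishes exactly on the
  line \<open>z = w = (x, 0)\<close>, where \<open>q - p\<close> vanishes as well.  Multiplying the bracket
  by \<open>p * q\<close> makes it disappear to second order at \<open>z = 0\<close> and at \<open>w = 0\<close>,
  which keeps these two circles critical.  The summand \<open>(p + q) * (q - p)\<^sup>2\<close> keeps the factor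
  positive there and makes the product homogeneous, of degree 8.
\<close>

definition merging_poly :: "real \<Rightarrow> real \<Rightarrow> real \<Rightarrow> real \<Rightarrow> real" where
  "merging_poly x y u v = (let p = x\<^sup>2 + y\<^sup>2; q = u\<^sup>2 + v\<^sup>2 in
     (q - p) * ((p + q) * (q - p)\<^sup>2 + 2 * p * q * (p + q - 2 * x * u)))"

definition merging_poly_deriv ::
  "real \<Rightarrow> real \<Rightarrow> real \<Rightarrow> real \<Rightarrow> real \<Rightarrow> real \<Rightarrow> real \<Rightarrow> real \<Rightarrow> real" where
  "merging_poly_deriv x y u v x' y' u' v' =
    (let p = x\<^sup>2 + y\<^sup>2; q = u\<^sup>2 + v\<^sup>2; e = p + q - 2 * x * u;
         p' = 2 * (x * x' + y * y'); q' = 2 * (u * u' + v * v');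
         e' = p' + q' - 2 * (x' * u + x * u') in
     (q' - p') * ((p + q) * (q - p)\<^sup>2 + 2 * p * q * e) +
     (q - p) * ((p' + q') * (q - p)\<^sup>2 + 2 * (p + q) * (q - p) * (q' - p') +
       2 * (p' * q * e + p * q' * e + p * q * e')))"

lemma has_derivative_merging_poly:
  fixes a b c d :: "'a::euclidean_space \<Rightarrow> real"
  assumes "bounded_linear a" "bounded_linear b" "bounded_linear c" "bounded_linear d"
  shows "((\<lambda>z. merging_poly (a z) (b z) (c z) (d z)) has_derivative
    (\<lambda>h. merging_poly_deriv (a z) (b z) (c z) (d z) (a h) (b h) (c h) (d h))) (at z)"
proof -
  note [derivative_intros] = assms[THEN bounded_linear_imp_has_derivative]
  define p where "p = (\<lambda>z. (a z)\<^sup>2 + (b z)\<^sup>2)"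
  define q where "q = (\<lambda>z. (c z)\<^sup>2 + (d z)\<^sup>2)"
  define e where "e = (\<lambda>z. p z + q z - 2 * a z * c z)"
  define p' where "p' = (\<lambda>h. 2 * (a z * a h + b z * b h))"
  define q' where "q' = (\<lambda>h. 2 * (c z * c h + d z * d h))"
  define e' where "e' = (\<lambda>h. p' h + q' h - 2 * (a h * c z + a z * c h))"
  have p[derivative_intros]: "(p has_derivative p') (at z)"
    unfolding p_def p'_def by (auto intro!: derivative_eq_intros simp: algebra_simps)
  have q[derivative_intros]: "(q has_derivative q') (at z)"
    unfolding q_def q'_def by (auto intro!: derivative_eq_intros simp: algebra_simps)
  have e[derivative_intros]: "(e has_derivative e') (at z)"
    unfolding e_def e'_def by (auto intro!: derivative_eq_intros simp: algebra_simps)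
  have "((\<lambda>z. (q z - p z) * ((p z + q z) * (q z - p z)\<^sup>2 + 2 * p z * q z * e z)) has_derivative
    (\<lambda>h. (q' h - p' h) * ((p z + q z) * (q z - p z)\<^sup>2 + 2 * p z * q z * e z) +
     (q z - p z) * ((p' h + q' h) * (q z - p z)\<^sup>2 +
       2 * (p z + q z) * (q z - p z) * (q' h - p' h) +
       2 * (p' h * q z * e z + p z * q' h * e z + p z * q z * e' h)))) (at z)"
    by (rule derivative_eq_intros refl)+ (simp add: fun_eq_iff power2_eq_square algebra_simps)
  then show ?thesis
    unfolding merging_poly_def merging_poly_deriv_def Let_def p_def q_def e_def p'_def q'_def e'_def .
qed

text \<open>Euler's identity for a homogeneous function of degree 8.\<close>

lemma merging_poly_deriv_radial: "merging_poly_deriv x y u v x y u v = 8 * merging_poly x y u v"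
proof -
  define p q e where "p = x\<^sup>2 + y\<^sup>2" and "q = u\<^sup>2 + v\<^sup>2" and "e = p + q - 2 * x * u"
  have eq: "2 * (x * x + y * y) = 2 * p" "2 * (u * u + v * v) = 2 * q"
    "2 * p + 2 * q - 2 * (x * u + x * u) = 2 * e"
    by (simp_all add: p_def q_def e_def power2_eq_square algebra_simps)
  show ?thesis
    unfolding merging_poly_def merging_poly_deriv_def Let_def p_def[symmetric] q_def[symmetric] eq e_def[symmetric]
    by algebra
qed

text \<open>
  The direction \<open>(q z, - p w)\<close> is tangent to the sphere and moves norm from \<open>w\<close> to
  \<open>z\<close>, fixing all angles.  This single direction detects all critical points on the
  three-sphere.
\<close>

lemma merging_poly_deriv_exchange:
  assumes "p = x\<^sup>2 + y\<^sup>2" "q = u\<^sup>2 + v\<^sup>2"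
  shows "merging_poly_deriv x y u v (q * x) (q * y) (- p * u) (- p * v) =
    - 4 * p * q * (2 * (p + q) * (q - p)\<^sup>2 + 3 * (q - p)\<^sup>2 * (x * u) +
      2 * p * q * (p + q - 2 * x * u))"
proof -
  have eq: "2 * (x * (q * x) + y * (q * y)) = 2 * p * q"
    "2 * (u * (- p * u) + v * (- p * v)) = - 2 * p * q"
    by (simp_all add: assms power2_eq_square algebra_simps)
  show ?thesis
    unfolding merging_poly_deriv_def Let_def assms[symmetric] eq by algebra
qed

text \<open>
  Since \<open>2 * x * u \<ge> - (p + q)\<close>, the negative contribution of the middle summand is at
  most three quarters of the first one, so the expression is a sum of nonnegative terms.
\<close>

lemma exchange_factor_eq_0:
  fixes x y u v :: real
  assumes "p = x\<^sup>2 + y\<^sup>2" "q = u\<^sup>2 + v\<^sup>2"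
    and "2 * (p + q) * (q - p)\<^sup>2 + 3 * (q - p)\<^sup>2 * (x * u) +
      2 * p * q * (p + q - 2 * x * u) = 0"
    and "p \<noteq> 0" "q \<noteq> 0"
  shows "u = x \<and> y = 0 \<and> v = 0"
proof -
  have pq: "p > 0" "q > 0"
    using assms by (auto simp: less_le)
  have E: "p + q - 2 * x * u = (x - u)\<^sup>2 + y\<^sup>2 + v\<^sup>2"
    by (simp add: assms power2_eq_square algebra_simps)
  have "0 \<le> (x + u)\<^sup>2 + y\<^sup>2 + v\<^sup>2" by simp
  also have "\<dots> = p + q + 2 * x * u"
    by (simp add: assms power2_eq_square algebra_simps)
  finally have "0 \<le> 3 / 2 * (p + q + 2 * x * u)" by simp
  moreover have "2 * (p + q) + 3 * (x * u) = 3 / 2 * (p + q + 2 * x * u) + (p + q) / 2"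
    by (simp add: field_simps)
  ultimately have "2 * (p + q) + 3 * (x * u) > 0" using pq by simp
  then have "0 \<le> (2 * (p + q) + 3 * (x * u)) * (q - p)\<^sup>2" by simp
  moreover have "(2 * (p + q) + 3 * (x * u)) * (q - p)\<^sup>2 + 2 * p * q * (p + q - 2 * x * u) = 0"
    using assms(3) by (simp add: algebra_simps)
  moreover have "2 * p * q * (p + q - 2 * x * u) \<ge> 0"
    unfolding E using pq by simp
  ultimately have "2 * p * q * (p + q - 2 * x * u) = 0" by linarith
  then have "(x - u)\<^sup>2 + y\<^sup>2 + v\<^sup>2 = 0" using pq unfolding E by simp
  then have "(x - u)\<^sup>2 = 0 \<and> y\<^sup>2 = 0 \<and> v\<^sup>2 = 0"
    using zero_le_power2[of "x - u"] zero_le_power2[of y] zero_le_power2[of v] by linarith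
  then show ?thesis by simp
qed

text \<open>
  The fifth coordinate \<open>t\<close> does not occur in the polynomial.  Off the equator \<open>t = 0\<close>, moving
  along the meridian changes only the norm of \<open>(z, w)\<close>, and by homogeneity the polynomial
  has to vanish at a critical point.  The circles \<open>z = 0\<close> and \<open>w = 0\<close> are therefore
  confined to the equator, while the line \<open>z = w = (x, 0)\<close>, on which the polynomial is
  zero, sweeps out a great circle through the poles.
\<close>

lemma merging_poly_critical:
  assumes sph: "x\<^sup>2 + y\<^sup>2 + u\<^sup>2 + v\<^sup>2 + t\<^sup>2 = 1"
  shows "(\<forall>x' y' u' v' t'. x * x' + y * y' + u * u' + v * v' + t * t' = 0 \<longrightarrow>
      merging_poly_deriv x y u v x' y' u' v' = 0) \<longleftrightarrow>
    (u = 0 \<and> v = 0 \<and> t = 0) \<or> (x = 0 \<and> y = 0 \<and> t = 0) \<or> (u = x \<and> y = 0 \<and> v = 0)"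
    (is "?L \<longleftrightarrow> ?R")
proof
  assume L: ?L
  define p q where "p = x\<^sup>2 + y\<^sup>2" and "q = u\<^sup>2 + v\<^sup>2"
  have p0: "p = 0 \<longleftrightarrow> x = 0 \<and> y = 0" and q0: "q = 0 \<longleftrightarrow> u = 0 \<and> v = 0"
    by (auto simp: p_def q_def sum_power2_eq_zero_iff)
  have "x * (q * x) + y * (q * y) + u * (- p * u) + v * (- p * v) + t * 0 = 0"
    by (simp add: p_def q_def power2_eq_square algebra_simps)
  with L have "merging_poly_deriv x y u v (q * x) (q * y) (- p * u) (- p * v) = 0" by blast
  then have "p = 0 \<or> q = 0 \<or> (u = x \<and> y = 0 \<and> v = 0)"
    unfolding merging_poly_deriv_exchange[OF p_def q_def]
    using exchange_factor_eq_0[OF p_def q_def] by auto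
  moreover have "t = 0 \<or> merging_poly x y u v = 0"
  proof -
    \<comment> \<open>The meridian direction, multiplied by \<open>t\<close> to avoid a division.\<close>
    have "x * (t\<^sup>2 * x) + y * (t\<^sup>2 * y) + u * (t\<^sup>2 * u) + v * (t\<^sup>2 * v) + t * (- (p + q) * t) = 0"
      by (simp add: p_def q_def power2_eq_square algebra_simps)
    with L have "merging_poly_deriv x y u v (t\<^sup>2 * x) (t\<^sup>2 * y) (t\<^sup>2 * u) (t\<^sup>2 * v) = 0" by blast
    moreover have "merging_poly_deriv x y u v (t\<^sup>2 * x) (t\<^sup>2 * y) (t\<^sup>2 * u) (t\<^sup>2 * v) =
        t\<^sup>2 * merging_poly_deriv x y u v x y u v"
      unfolding merging_poly_deriv_def Let_def by algebra
    ultimately show ?thesis by (simp add: merging_poly_deriv_radial)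
  qed
  moreover have "merging_poly x y u v = (q - p) ^ 3 * (p + q)" if "p = 0 \<or> q = 0"
    using that unfolding merging_poly_def Let_def p_def[symmetric] q_def[symmetric]
    by (auto simp: power2_eq_square power3_eq_cube)
  ultimately show ?R
    using p0 q0 by auto
next
  assume ?R
  then show ?L
  proof (elim disjE conjE; intro allI impI)
    fix x' y' u' v' t' :: real
    assume "x * x' + y * y' + u * u' + v * v' + t * t' = 0"
    moreover {
      assume "u = 0" "v = 0" "t = 0"
      then have "merging_poly_deriv x y u v x' y' u' v' =
          - 8 * (x\<^sup>2 + y\<^sup>2) ^ 3 * (x * x' + y * y' + u * u' + v * v' + t * t')"
        unfolding merging_poly_deriv_def Let_def by algebra }
    moreover {
      assume "x = 0" "y = 0" "t = 0"
      then have "merging_poly_deriv x y u v x' y' u' v' =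
          8 * (u\<^sup>2 + v\<^sup>2) ^ 3 * (x * x' + y * y' + u * u' + v * v' + t * t')"
        unfolding merging_poly_deriv_def Let_def by algebra }
    moreover {
      assume "u = x" "y = 0" "v = 0"
      then have "merging_poly_deriv x y u v x' y' u' v' = 0"
        by (simp add: merging_poly_deriv_def power2_eq_square) }
    ultimately show "u = 0 \<Longrightarrow> v = 0 \<Longrightarrow> t = 0 \<Longrightarrow> merging_poly_deriv x y u v x' y' u' v' = 0"
      "x = 0 \<Longrightarrow> y = 0 \<Longrightarrow> t = 0 \<Longrightarrow> merging_poly_deriv x y u v x' y' u' v' = 0"
      "u = x \<Longrightarrow> y = 0 \<Longrightarrow> v = 0 \<Longrightarrow> merging_poly_deriv x y u v x' y' u' v' = 0"
      by auto
  qed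
qed

lemma merging_poly_le:
  fixes x y u v :: real
  defines "s \<equiv> x\<^sup>2 + y\<^sup>2 + u\<^sup>2 + v\<^sup>2"
  shows "merging_poly x y u v \<le> 2 * s ^ 4"
proof -
  define p q e where "p = x\<^sup>2 + y\<^sup>2" and "q = u\<^sup>2 + v\<^sup>2" and "e = p + q - 2 * x * u"
  have pq: "p \<ge> 0" "q \<ge> 0" and s: "s = p + q" by (simp_all add: p_def q_def s_def)
  have e0: "e \<ge> 0"
  proof -
    have "e = (x - u)\<^sup>2 + y\<^sup>2 + v\<^sup>2"
      by (simp add: p_def q_def e_def power2_eq_square algebra_simps)
    then show ?thesis by simp
  qed
  have e1: "e \<le> 2 * s"
  proof -
    have "2 * s - e = (x + u)\<^sup>2 + y\<^sup>2 + v\<^sup>2"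
      by (simp add: p_def q_def e_def s_def power2_eq_square algebra_simps)
    moreover have "\<dots> \<ge> 0" by simp
    ultimately show ?thesis by linarith
  qed
  have D: "(q - p)\<^sup>2 \<le> s\<^sup>2"
    using pq by (intro power2_le_iff_abs_le[THEN iffD2]) (auto simp: s)
  have "4 * (p * q) = s\<^sup>2 - (q - p)\<^sup>2" by (simp add: s power2_eq_square algebra_simps)
  then have pq2: "4 * (p * q) \<le> s\<^sup>2" by simp
  have "4 * (p * q) * e \<le> s\<^sup>2 * (2 * s)"
    using pq e0 e1 pq2 by (intro mult_mono) auto
  moreover have "s * (q - p)\<^sup>2 \<le> s * s\<^sup>2" using D pq s by (intro mult_left_mono) auto
  ultimately have G: "s * (q - p)\<^sup>2 + 2 * p * q * e \<le> 2 * s ^ 3"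
    by (simp add: power2_eq_square power3_eq_cube ac_simps)
  have G0: "0 \<le> s * (q - p)\<^sup>2 + 2 * p * q * e" using pq e0 s by simp
  have "merging_poly x y u v = (q - p) * (s * (q - p)\<^sup>2 + 2 * p * q * e)"
    unfolding merging_poly_def Let_def s e_def p_def q_def by simp
  also have "\<dots> \<le> s * (2 * s ^ 3)"
    using G G0 pq s by (intro mult_mono) auto
  finally show ?thesis by (simp add: power4_eq_xxxx power3_eq_cube)
qed

section \<open>Spheres of even and of odd dimension\<close>

lemma even_sphere_P_function:
  fixes c :: "nat \<Rightarrow> 'n::finite"
  assumes inj: "inj_on c {..<5}" and k: "CARD('n) = 5 + 2 * k"
  shows "\<exists>(f :: real ^ 'n \<Rightarrow> real) \<C>.
    P_function (sphere 0 1 :: (real ^ 2) set) (sphere 0 1) f \<C> \<and>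
    finite \<C> \<and> card \<C> \<le> k + 3"
proof -
  define C where "C = c ` {..<5}"
  have five: "{..<5} = {0, 1, 2, 3, 4::nat}" by auto
  have C: "C = {c 0, c 1, c 2, c 3, c 4}" by (simp add: C_def five)
  have dist: "c i = c j \<longleftrightarrow> i = j" if "i < 5" "j < 5" for i j
    using inj that by (auto simp: inj_on_def)
  define F where "F = (\<lambda>x :: real ^ 'n. merging_poly (x $ c 0) (x $ c 1) (x $ c 2) (x $ c 3))"
  define D where "D = (\<lambda>x h :: real ^ 'n. merging_poly_deriv (x $ c 0) (x $ c 1) (x $ c 2) (x $ c 3)
    (h $ c 0) (h $ c 1) (h $ c 2) (h $ c 3))"
  define A where "A = coord_subspace {c 0, c 1}"
  define B where "B = coord_subspace {c 2, c 3}"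
  define K where "K = {x \<in> coord_subspace {c 0, c 2, c 4}. x $ c 2 = x $ c 0}"
  have sumC: "(\<Sum>i\<in>UNIV. g i) = g (c 0) + g (c 1) + g (c 2) + g (c 3) + g (c 4)"
    if "\<And>i. i \<notin> C \<Longrightarrow> g i = 0" for g :: "'n \<Rightarrow> real"
  proof -
    have "(\<Sum>i\<in>UNIV. g i) = (\<Sum>i\<in>C. g i)"
      using that by (intro sum.mono_neutral_right) auto
    also have "\<dots> = (\<Sum>j<5. g (c j))" unfolding C_def by (simp add: sum.reindex[OF inj])
    finally show ?thesis by (simp add: five algebra_simps)
  qed
  have innerC: "x \<bullet> h = x $ c 0 * h $ c 0 + x $ c 1 * h $ c 1 + x $ c 2 * h $ c 2 +
      x $ c 3 * h $ c 3 + x $ c 4 * h $ c 4" if "x \<in> coord_subspace C" for x h :: "real ^ 'n"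
    unfolding inner_vec_def using that by (subst sumC) (auto simp: coord_subspace_def)
  have restC: "coord_restrict C x \<in> coord_subspace C" for x :: "real ^ 'n"
    by (simp add: coord_restrict_def coord_subspace_def)
  have restC_nth: "coord_restrict C x $ c j = x $ c j" if "j < 5" for x :: "real ^ 'n" and j
    using that by (simp add: coord_restrict_def C_def)
  have "\<exists>(f :: real ^ 'n \<Rightarrow> real) \<C>.
    P_function (sphere 0 1 :: (real ^ 2) set) (sphere 0 1) f \<C> \<and>
    finite \<C> \<and> card \<C> \<le> k + card {A, B, K}"
    \<comment> \<open>The growth bound is Euler's factor 8 times the bound 2 on the unit sphere, that is \<open>2 * M\<close>.\<close>
  proof (rule P_function_join[where F = F and D = D and C = C and M = 8])
    show "smooth_on_open F UNIV"
      unfolding F_def merging_poly_def Let_def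
      by (intro smooth_on_open_add smooth_on_open_diff smooth_on_open_mult smooth_on_open_const
          smooth_on_open_power smooth_on_open_vec_nth open_UNIV)
    show "(F has_derivative D x) (at x)" for x
      unfolding F_def D_def by (intro has_derivative_merging_poly bounded_linear_vec_nth)
    show "D x (axis i 1) = 0" if "i \<notin> C" for x i
    proof -
      have "axis i 1 $ c j = (0::real)" if "j < 5" for j
        using \<open>i \<notin> C\<close> that by (auto simp: axis_def C_def)
      then show ?thesis by (simp add: D_def merging_poly_deriv_def)
    qed
    show "D x h = 0" if "x \<in> coord_subspace (- C)" for x h
    proof -
      have "x $ c j = 0" if "j < 5" for j
        using \<open>x \<in> coord_subspace (- C)\<close> that by (auto simp: coord_subspace_def C_def)
      then show ?thesis by (simp add: D_def merging_poly_deriv_def)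
    qed
    show "D x (coord_restrict C x) \<le> 2 * 8 * (coord_restrict C x \<bullet> coord_restrict C x)"
      if nx: "norm x = 1" for x
    proof -
      define s where "s = (x $ c 0)\<^sup>2 + (x $ c 1)\<^sup>2 + (x $ c 2)\<^sup>2 + (x $ c 3)\<^sup>2"
      have rr: "coord_restrict C x \<bullet> coord_restrict C x = s + (x $ c 4)\<^sup>2"
        using innerC[OF restC] restC_nth by (simp add: s_def power2_eq_square)
      have "s + (x $ c 4)\<^sup>2 \<le> x \<bullet> x"
        unfolding rr[symmetric] inner_vec_def
        by (intro sum_mono) (auto simp: coord_restrict_def)
      then have s: "0 \<le> s" "s \<le> 1" "s \<le> s + (x $ c 4)\<^sup>2"
        using nx by (auto simp: norm_eq_1 s_def intro: order_trans[rotated])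
      have "D x (coord_restrict C x) = 8 * F x"
        using restC_nth by (simp add: D_def F_def merging_poly_deriv_radial)
      also have "\<dots> \<le> 16 * s ^ 4"
        using merging_poly_le[of "x $ c 0" "x $ c 1" "x $ c 2" "x $ c 3"] by (simp add: F_def s_def)
      also have "\<dots> \<le> 16 * s"
        using power_decreasing[of 1 4 s] s by simp
      also have "\<dots> \<le> 16 * (s + (x $ c 4)\<^sup>2)" using s(3) by simp
      finally show ?thesis by (simp add: rr)
    qed
    have "dim K = 2"
    proof -
      define a where "a = axis (c 0) 1 + axis (c 2) (1::real)"
      define b where "b = axis (c 4) (1::real)"
      have "K = span {a, b}"
      proof (intro subset_antisym subsetI)
        fix x assume x: "x \<in> K"
        have "x = x $ c 0 *\<^sub>R a + x $ c 4 *\<^sub>R b"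
        proof (rule vec_eq_iff[THEN iffD2], rule allI)
          fix i
          have "x $ c 2 = x $ c 0" "i \<notin> {c 0, c 2, c 4} \<Longrightarrow> x $ i = 0"
            using x by (auto simp: K_def coord_subspace_def)
          then show "x $ i = (x $ c 0 *\<^sub>R a + x $ c 4 *\<^sub>R b) $ i"
            by (cases "i \<in> {c 0, c 2, c 4}") (auto simp: a_def b_def axis_def dist)
        qed
        then show "x \<in> span {a, b}"
          by (metis span_add span_base span_scale insertI1 insertI2 singletonI)
      next
        have "subspace K"
          by (auto simp: K_def subspace_def coord_subspace_def)
        moreover have "{a, b} \<subseteq> K"
          by (auto simp: a_def b_def K_def coord_subspace_def axis_def dist)
        ultimately show "x \<in> K" if "x \<in> span {a, b}" for x
          using that span_minimal by blast
      qed
      moreover have "independent {a, b}" "a \<noteq> b"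
      proof -
        have "b $ c 0 = 0" "b $ c 2 = 0" by (simp_all add: b_def axis_def dist)
        then have "a \<bullet> b = 0" by (simp add: a_def inner_add_left inner_axis')
        moreover have "a $ c 0 \<noteq> 0" "b $ c 4 \<noteq> 0"
          by (simp_all add: a_def b_def axis_def dist)
        ultimately have ab: "a \<bullet> b = 0" "a \<noteq> 0" "b \<noteq> 0" by auto
        then show "a \<noteq> b" by auto
        show "independent {a, b}"
          by (rule pairwise_orthogonal_independent)
            (use ab in \<open>auto simp: pairwise_def orthogonal_def inner_commute\<close>)
      qed
      ultimately show ?thesis by (simp add: dim_eq_card_independent)
    qed
    then show "subspace L \<and> dim L = 2 \<and> L \<subseteq> coord_subspace C" if "L \<in> {A, B, K}" for L
      using that
      by (auto simp: A_def B_def subspace_coord_subspace dim_coord_subspace dist)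
        (auto simp: K_def C coord_subspace_def subspace_def)
    show "L \<inter> L' \<subseteq> {0}" if "L \<in> {A, B, K}" "L' \<in> {A, B, K}" "L \<noteq> L'" for L L'
    proof -
      have "{c 0, c 1} \<inter> {c 2, c 3} = {}" by (auto simp: dist)
      then have AB: "A \<inter> B \<subseteq> {0}"
        by (simp add: A_def B_def coord_subspace_Int coord_subspace_empty)
      have K0: "x = 0" if "x \<in> K" "x $ c 0 = 0 \<or> x $ c 2 = 0" "x $ c 4 = 0" for x
        using that by (auto simp: K_def coord_subspace_def vec_eq_iff) metis+
      have AK: "A \<inter> K \<subseteq> {0}" and BK: "B \<inter> K \<subseteq> {0}"
        using K0 by (auto simp: A_def B_def coord_subspace_def dist)
      show ?thesis using that AB AK BK by (auto simp: Int_commute)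
    qed
    show "{x \<in> coord_subspace C. norm x = 1 \<and> (\<forall>h. x \<bullet> h = 0 \<longrightarrow> D x h = 0)} =
      sphere 0 1 \<inter> \<Union>{A, B, K}"
    proof -
      have eq: "(\<forall>h. x \<bullet> h = 0 \<longrightarrow> D x h = 0) \<longleftrightarrow> x \<in> A \<union> B \<union> K"
        if xC: "x \<in> coord_subspace C" and nx: "norm x = 1" for x
      proof -
        let ?P = "\<lambda>x' y' u' v' t'. x $ c 0 * x' + x $ c 1 * y' + x $ c 2 * u' + x $ c 3 * v' +
          x $ c 4 * t' = 0 \<longrightarrow>
          merging_poly_deriv (x $ c 0) (x $ c 1) (x $ c 2) (x $ c 3) x' y' u' v' = 0"
        have "(\<forall>h. x \<bullet> h = 0 \<longrightarrow> D x h = 0) \<longleftrightarrow>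
          (\<forall>h :: real ^ 'n. ?P (h $ c 0) (h $ c 1) (h $ c 2) (h $ c 3) (h $ c 4))"
          by (simp add: innerC[OF xC] D_def)
        also have "\<dots> \<longleftrightarrow> (\<forall>x' y' u' v' t'. ?P x' y' u' v' t')"
        proof (intro iffI allI)
          fix x' y' u' v' t'
          assume H: "\<forall>h :: real ^ 'n. ?P (h $ c 0) (h $ c 1) (h $ c 2) (h $ c 3) (h $ c 4)"
          define h :: "real ^ 'n" where
            "h = (\<chi> i. if i = c 0 then x' else if i = c 1 then y' else if i = c 2 then u'
              else if i = c 3 then v' else t')"
          have "h $ c 0 = x'" "h $ c 1 = y'" "h $ c 2 = u'" "h $ c 3 = v'" "h $ c 4 = t'"
            by (simp_all add: h_def dist)
          with H[rule_format, of h] show "?P x' y' u' v' t'" by simp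
        qed blast
        also have "\<dots> \<longleftrightarrow> (x $ c 2 = 0 \<and> x $ c 3 = 0 \<and> x $ c 4 = 0) \<or>
          (x $ c 0 = 0 \<and> x $ c 1 = 0 \<and> x $ c 4 = 0) \<or>
          (x $ c 2 = x $ c 0 \<and> x $ c 1 = 0 \<and> x $ c 3 = 0)"
          using nx innerC[OF xC, of x] by (intro merging_poly_critical) (simp add: norm_eq_1 power2_eq_square)
        also have "\<dots> \<longleftrightarrow> x \<in> A \<union> B \<union> K"
        proof -
          have "x \<in> A \<longleftrightarrow> x $ c 2 = 0 \<and> x $ c 3 = 0 \<and> x $ c 4 = 0"
            "x \<in> B \<longleftrightarrow> x $ c 0 = 0 \<and> x $ c 1 = 0 \<and> x $ c 4 = 0"
            "x \<in> K \<longleftrightarrow> x $ c 2 = x $ c 0 \<and> x $ c 1 = 0 \<and> x $ c 3 = 0"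
            using xC by (auto simp: A_def B_def K_def coord_subspace_def C dist) metis+
          then show ?thesis by blast
        qed
        finally show ?thesis .
      qed
      have sub: "A \<union> B \<union> K \<subseteq> coord_subspace C"
        by (auto simp: A_def B_def K_def coord_subspace_def C)
      show ?thesis
      proof (rule set_eqI)
        fix x
        show "x \<in> {x \<in> coord_subspace C. norm x = 1 \<and> (\<forall>h. x \<bullet> h = 0 \<longrightarrow> D x h = 0)} \<longleftrightarrow>
          x \<in> sphere 0 1 \<inter> \<Union>{A, B, K}"
        proof (cases "x \<in> coord_subspace C \<and> norm x = 1")
          case True
          with eq[of x] show ?thesis by simp
        next
          case False
          with sub show ?thesis by auto
        qed
      qed
    qed
    have "card C = 5" unfolding C_def by (simp add: card_image[OF inj])
    then show "card (- C) = 2 * k" by (simp add: Compl_eq_Diff_UNIV card_Diff_subset k)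
  qed simp
  moreover have "card {A, B, K} \<le> 3" by (simp add: card_insert_if)
  ultimately show ?thesis by (meson add_left_mono order_trans)
qed

text \<open>
  With all coordinates paired, the weighted sum of squares by itself is the function sought.
\<close>

lemma odd_sphere_P_function:
  assumes k: "CARD('n::finite) = 2 * k"
  shows "\<exists>(f :: real ^ 'n \<Rightarrow> real) \<C>.
    P_function (sphere 0 1 :: (real ^ 2) set) (sphere 0 1) f \<C> \<and>
    finite \<C> \<and> card \<C> \<le> k"
proof -
  have "\<exists>(f :: real ^ 'n \<Rightarrow> real) \<C>.
    P_function (sphere 0 1 :: (real ^ 2) set) (sphere 0 1) f \<C> \<and>
    finite \<C> \<and> card \<C> \<le> k + card ({} :: (real ^ 'n) set set)"
    by (rule P_function_join[where F = "\<lambda>_. 0" and D = "\<lambda>_ _. 0" and C = "{}" and M = 0])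
      (auto simp: k smooth_on_open_const coord_subspace_empty)
  then show ?thesis by simp
qed

theorem theorem3p6:
  fixes n :: nat
  assumes "n \<ge> 3" and "CARD('n::finite) = n + 1"
  shows "\<exists>(f :: real ^ 'n \<Rightarrow> real) \<C>.
           P_function (sphere 0 1 :: (real ^ 2) set) (sphere 0 1 :: (real ^ 'n) set) f \<C> \<and>
           finite \<C> \<and> card \<C> \<le> n div 2 + 1"
proof (cases "even n")
  case True
  define k where "k = n div 2 - 2"
  have card: "CARD('n) = 5 + 2 * k" and n: "n div 2 + 1 = k + 3"
    using True assms by (auto simp: k_def elim!: evenE)
  \<comment> \<open>Five coordinates carry the four-sphere; an even number remains.\<close>
  obtain c :: "nat \<Rightarrow> 'n" where "bij_betw c {0..<CARD('n)} UNIV"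
    using ex_bij_betw_nat_finite[of "UNIV :: 'n set"] by auto
  then have "inj_on c {..<5}"
    by (rule inj_on_subset[OF bij_betw_imp_inj_on]) (auto simp: card)
  then show ?thesis
    unfolding n using card by (rule even_sphere_P_function)
next
  case False
  then have "CARD('n) = 2 * (n div 2 + 1)" using assms by (auto elim: oddE)
  then show ?thesis by (rule odd_sphere_P_function)
qed

end
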